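(* Let $\mathscr{H}$ be a complex Hilbert space and let $T\in \mathbb{B}(\mathscr{H})$. Then $$w(T)=\frac12\|T\|+\frac12\big|\|Re(T)\|-\|Im(T)\|\big|$$ if and only if both $\|T\|=\|Re(T)\|+\|Im(T)\|$ and $w(T)=\max\{ \|Re(T)\|, \|Im(T)\|\}$.
   Context: $\mathbb{B}(\mathscr{H})$ denotes the bounded linear operators on $\mathscr{H}$, $\|\cdot\|$ the operator norm. $Re(T)=\frac12(T+T^* )$ and $Im(T)=\frac1{2i}(T-T^* )$. The numerical radius is $w(T)=\sup\{|\langle Tx,x\rangle| : x\in\mathscr{H},\ \|x\|=1\}$. *)

theory Defs
  imports "HOL-Analysis.Analysis"
begin

text \<open>
  Complex Hilbert spaces. The inner product is linear in the first argument and conjugate linear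
  in the second; the inherited real structure and norm are tied to the complex ones. The
  zero space is not excluded.
\<close>

class complex_inner = real_normed_vector +
  fixes scaleC :: "complex \<Rightarrow> 'a \<Rightarrow> 'a" (infixr "*\<^sub>C" 75)
    and cinner :: "'a \<Rightarrow> 'a \<Rightarrow> complex"
  assumes scaleC_add_right: "a *\<^sub>C (x + y) = a *\<^sub>C x + a *\<^sub>C y"
    and scaleC_add_left: "(a + b) *\<^sub>C x = a *\<^sub>C x + b *\<^sub>C x"
    and scaleC_scaleC: "a *\<^sub>C (b *\<^sub>C x) = (a * b) *\<^sub>C x"
    and scaleC_one: "1 *\<^sub>C x = x"
    and scaleR_scaleC: "r *\<^sub>R x = complex_of_real r *\<^sub>C x"
    and cinner_commute: "cinner x y = cnj (cinner y x)"
    and cinner_add_left: "cinner (x + y) z = cinner x z + cinner y z"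
    and cinner_scaleC_left: "cinner (a *\<^sub>C x) y = a * cinner x y"
    and cinner_ge_zero: "0 \<le> Re (cinner x x)"
    and cinner_eq_zero_iff: "cinner x x = 0 \<longleftrightarrow> x = 0"
    and norm_eq_sqrt_cinner: "norm x = sqrt (Re (cinner x x))"

class chilbert_space = complex_inner + banach

instantiation complex :: chilbert_space
begin

definition scaleC_complex :: "complex \<Rightarrow> complex \<Rightarrow> complex" where
  "scaleC_complex a x = a * x"

definition cinner_complex :: "complex \<Rightarrow> complex \<Rightarrow> complex" where
  "cinner_complex x y = x * cnj y"

instance
proof
  fix x :: complex
  show "norm x = sqrt (Re (cinner x x))"
    by (simp add: cinner_complex_def cmod_def power2_eq_square)
qed (simp_all add: scaleC_complex_def cinner_complex_def algebra_simps scaleR_conv_of_real)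

end

text \<open>Elements of \<open>\<bbbB>(H)\<close> are functions satisfying the following predicate; the operator norm is
  \<^const>\<open>onorm\<close>.\<close>

definition bounded_clinear :: "('a::complex_inner \<Rightarrow> 'a) \<Rightarrow> bool" where
  "bounded_clinear T \<longleftrightarrow> bounded_linear T \<and> (\<forall>c x. T (c *\<^sub>C x) = c *\<^sub>C T x)"

definition cadjoint :: "('a::complex_inner \<Rightarrow> 'a) \<Rightarrow> 'a \<Rightarrow> 'a" where
  "cadjoint T = (THE S. \<forall>x y. cinner (T x) y = cinner x (S y))"

definition op_Re :: "('a::complex_inner \<Rightarrow> 'a) \<Rightarrow> 'a \<Rightarrow> 'a" where
  "op_Re T = (\<lambda>x. (1 / 2) *\<^sub>C (T x + cadjoint T x))"

definition op_Im :: "('a::complex_inner \<Rightarrow> 'a) \<Rightarrow> 'a \<Rightarrow> 'a" where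
  "op_Im T = (\<lambda>x. (1 / (2 * \<i>)) *\<^sub>C (T x - cadjoint T x))"

definition numerical_radius :: "('a::complex_inner \<Rightarrow> 'a) \<Rightarrow> real" where
  "numerical_radius T = Sup {cmod (cinner (T x) x) | x. norm x = 1}"

end

(* Write T = A + iB with A = Re T and B = Im T self-adjoint. Always \<parallel>T\<parallel> \<le> \<parallel>A\<parallel> + \<parallel>B\<parallel> and
   max \<parallel>A\<parallel> \<parallel>B\<parallel> \<le> w(T), because the norm of a self-adjoint operator is bounded by its quadratic
   form. Since max a b = (a + b)/2 + |a - b|/2, the first identity squeezes both inequalities
   into equalities, and conversely. *)

theory Submission imports Defs begin

section \<open>Inner product calculus and the Cauchy-Schwarz inequality\<close>

lemma cinner_add_right: "cinner x (y + z) = cinner x y + cinner x z"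
  by (metis cinner_add_left cinner_commute complex_cnj_add)

lemma cinner_scaleC_right: "cinner x (c *\<^sub>C y) = cnj c * cinner x y"
  by (metis cinner_commute cinner_scaleC_left complex_cnj_mult)

lemma cinner_scaleR_left: "cinner (r *\<^sub>R x) y = of_real r * cinner x y"
  by (simp add: scaleR_scaleC cinner_scaleC_left)

lemma cinner_scaleR_right: "cinner x (r *\<^sub>R y) = of_real r * cinner x y"
  by (simp add: scaleR_scaleC cinner_scaleC_right)

lemma cinner_minus_left: "cinner (- x) y = - cinner x y"
  using cinner_scaleR_left[of "-1" x y] by simp

lemma cinner_minus_right: "cinner x (- y) = - cinner x y"
  using cinner_scaleR_right[of x "-1" y] by simp

lemma cinner_diff_left: "cinner (x - y) z = cinner x z - cinner y z"
  using cinner_add_left[of x "- y" z] by (simp add: cinner_minus_left)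

lemma cinner_diff_right: "cinner x (y - z) = cinner x y - cinner x z"
  using cinner_add_right[of x y "- z"] by (simp add: cinner_minus_right)

lemma Re_cinner_commute: "Re (cinner x y) = Re (cinner y x)"
  by (subst cinner_commute) simp

lemma Re_cinner_self: "Re (cinner x x) = (norm x)\<^sup>2"
  by (simp add: norm_eq_sqrt_cinner cinner_ge_zero)

lemma cinner_self: "cinner x x = of_real ((norm x)\<^sup>2)"
proof -
  have "Im (cinner x x) = 0"
    using arg_cong[OF cinner_commute[of x x], of Im] by simp
  then show ?thesis
    by (simp add: complex_eq_iff Re_cinner_self del: of_real_power)
qed

lemma norm_add_sq:
  fixes x y :: "'a::complex_inner"
  shows "(norm (x + y))\<^sup>2 = (norm x)\<^sup>2 + 2 * Re (cinner x y) + (norm y)\<^sup>2"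
  by (simp add: Re_cinner_self[symmetric] cinner_add_left cinner_add_right Re_cinner_commute[of y x])

lemma norm_diff_sq:
  fixes x y :: "'a::complex_inner"
  shows "(norm (x - y))\<^sup>2 = (norm x)\<^sup>2 - 2 * Re (cinner x y) + (norm y)\<^sup>2"
  by (simp add: Re_cinner_self[symmetric] cinner_diff_left cinner_diff_right Re_cinner_commute[of y x])

lemma parallelogram_law:
  fixes x y :: "'a::complex_inner"
  shows "(norm (x + y))\<^sup>2 + (norm (x - y))\<^sup>2 = 2 * (norm x)\<^sup>2 + 2 * (norm y)\<^sup>2"
  by (simp add: norm_add_sq norm_diff_sq)

lemma norm_scaleC: "norm (c *\<^sub>C x) = cmod c * norm x"
proof -
  have "cinner (c *\<^sub>C x) (c *\<^sub>C x) = (c * cnj c) * cinner x x"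
    by (simp add: cinner_scaleC_left cinner_scaleC_right)
  then have "complex_of_real ((norm (c *\<^sub>C x))\<^sup>2) = of_real ((cmod c * norm x)\<^sup>2)"
    by (simp only: cinner_self complex_norm_square[symmetric] of_real_mult power_mult_distrib)
  then have "(norm (c *\<^sub>C x))\<^sup>2 = (cmod c * norm x)\<^sup>2"
    using of_real_eq_iff by blast
  then show ?thesis by simp
qed

text \<open>Scaling each vector by the norm of the other gives two vectors of equal norm, so the
  expanded square of their difference has \<open>norm x * norm y\<close> as a factor, which can be
  cancelled.\<close>

lemma Re_cinner_le: "Re (cinner x y) \<le> norm x * norm y"
proof (cases "x = 0 \<or> y = 0")
  case True
  then show ?thesis
    using cinner_scaleR_left[of 0 x y] cinner_scaleR_right[of x 0 y] by auto
next
  case False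
  let ?p = "norm x * norm y"
  have "0 \<le> (norm (norm y *\<^sub>R x - norm x *\<^sub>R y))\<^sup>2" by simp
  also have "\<dots> = 2 * (?p * (?p - Re (cinner x y)))"
    unfolding norm_diff_sq
    by (simp add: cinner_scaleR_left cinner_scaleR_right algebra_simps power2_eq_square)
  finally have "0 \<le> ?p * (?p - Re (cinner x y))" by simp
  moreover have "0 < ?p" using False by simp
  ultimately show ?thesis by (simp add: zero_le_mult_iff)
qed

text \<open>Rotating \<open>x\<close> by a unimodular scalar makes the inner product real and
  nonnegative, which reduces the modulus to the real part.\<close>

lemma cmod_cinner_le: "cmod (cinner x y) \<le> norm x * norm y"
proof -
  obtain c where c: "cmod c = 1" "c * cinner x y = of_real (cmod (cinner x y))"
  proof (cases "cinner x y = 0")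
    case False
    then show ?thesis
      by (intro that[of "of_real (cmod (cinner x y)) / cinner x y"]) (auto simp: norm_divide)
  qed (auto intro: that[of 1])
  have "cmod (cinner x y) = Re (cinner (c *\<^sub>C x) y)"
    by (simp add: cinner_scaleC_left c)
  also have "\<dots> \<le> norm x * norm y"
    using Re_cinner_le[of "c *\<^sub>C x" y] by (simp add: norm_scaleC c)
  finally show ?thesis .
qed

lemma cinner_eqI:
  assumes "\<And>x. cinner x u = cinner x v"
  shows "u = v"
proof -
  have "cinner (u - v) (u - v) = 0" using assms by (simp add: cinner_diff_right)
  then show ?thesis by (simp add: cinner_eq_zero_iff)
qed

section \<open>Riesz representation\<close>

text \<open>Supplies the existence of adjoints. A minimising sequence of a quadratic functional is
  Cauchy by the parallelogram law, and the vanishing first variation at its limit is the claimed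
  identity.\<close>

lemma riesz_representation_real:
  fixes g :: "'a::chilbert_space \<Rightarrow> real"
  assumes "bounded_linear g"
  shows "\<exists>y. \<forall>h. g h = Re (cinner h y)"
proof -
  interpret g: bounded_linear g by fact
  obtain K where K: "\<And>x. \<bar>g x\<bar> \<le> norm x * K" using g.bounded by auto
  (* the representing vector is the minimiser of this functional *)
  define F where "F y = (norm y)\<^sup>2 - 2 * g y" for y
  have F_lower: "- K\<^sup>2 \<le> F y" for y
  proof -
    have "0 \<le> (norm y - K)\<^sup>2" by simp
    also have "\<dots> = (norm y)\<^sup>2 - 2 * (norm y * K) + K\<^sup>2" by (simp add: power2_eq_square algebra_simps)
    also have "\<dots> \<le> F y + K\<^sup>2" using K[of y] by (simp add: F_def)
    finally show ?thesis by simp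
  qed
  define m where "m = Inf (range F)"
  have bdd: "bdd_below (range F)" using F_lower by (rule bdd_belowI2)
  have m_le: "m \<le> F y" for y unfolding m_def by (rule cInf_lower) (auto simp: bdd)
  have "\<exists>y. F y < m + 1 / real (Suc n)" for n
    using cInf_lessD[of "range F" "m + 1 / real (Suc n)"] by (auto simp: m_def)
  then obtain Y where Y: "\<And>n. F (Y n) < m + 1 / real (Suc n)" by metis
  \<comment> \<open>The parallelogram law expresses the distance through the value of
    \<open>F\<close> at the midpoint, which is at least \<open>m\<close>; near-minimisers are
    therefore close together.\<close>
  have dist_bound: "(norm (u - v))\<^sup>2 \<le> 2 * F u + 2 * F v - 4 * m" for u v
  proof -
    define h where "h = (1/2) *\<^sub>R (u + v)"
    have "(norm h)\<^sup>2 = (norm (u + v))\<^sup>2 / 4" "g h = (g u + g v) / 2"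
      by (simp_all add: h_def power_divide g.scaleR g.add)
    then have "(norm (u - v))\<^sup>2 = 2 * F u + 2 * F v - 4 * F h"
      using parallelogram_law[of u v] by (simp add: F_def)
    then show ?thesis using m_le[of h] by simp
  qed
  have "Cauchy Y"
  proof (rule CauchyI)
    fix e :: real assume "0 < e"
    then obtain N where N: "4 * (1 / real (Suc N)) < e\<^sup>2"
      using reals_Archimedean[of "e\<^sup>2 / 4"] by (auto simp: inverse_eq_divide)
    have small: "4 * F (Y n) < 4 * m + e\<^sup>2" if "N \<le> n" for n
    proof -
      have "1 / real (Suc n) \<le> 1 / real (Suc N)" using that by (simp add: frac_le)
      then show ?thesis using Y[of n] N by linarith
    qed
    have "norm (Y i - Y j) < e" if "N \<le> i" "N \<le> j" for i j
    proof -
      have "(norm (Y i - Y j))\<^sup>2 < e\<^sup>2"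
        using dist_bound[of "Y i" "Y j"] small[OF that(1)] small[OF that(2)] by linarith
      then show ?thesis using \<open>0 < e\<close> by (simp add: power2_less_imp_less)
    qed
    then show "\<exists>M. \<forall>i\<ge>M. \<forall>j\<ge>M. norm (Y i - Y j) < e" by blast
  qed
  then obtain y where y: "Y \<longlonglongrightarrow> y" using Cauchy_convergent convergent_def by blast
  have F_lim: "(\<lambda>n. F (Y n)) \<longlonglongrightarrow> F y"
    unfolding F_def by (intro tendsto_intros g.tendsto y)
  have bound_lim: "(\<lambda>n. m + 1 / real (Suc n)) \<longlonglongrightarrow> m"
    using tendsto_add[OF tendsto_const[of m] LIMSEQ_Suc[OF lim_1_over_n]] by simp
  have F_y: "F y \<le> m"
    using LIMSEQ_le[OF F_lim bound_lim] Y less_imp_le by blast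
  have "g h = Re (cinner h y)" for h
  proof (rule ccontr)
    define c where "c = Re (cinner y h) - g h"
    assume "g h \<noteq> Re (cinner h y)"
    then have "c \<noteq> 0" by (simp add: c_def Re_cinner_commute[of y h])
    \<comment> \<open>The increment of \<open>F\<close> along \<open>h\<close> is a quadratic in
      \<open>t\<close> with linear coefficient \<open>2 * c\<close>; it can stay nonnegative only if
      \<open>c = 0\<close>.\<close>
    have quad: "0 \<le> 2 * t * c + t\<^sup>2 * (norm h)\<^sup>2" for t
    proof -
      have "F (y + t *\<^sub>R h) = F y + 2 * t * c + t\<^sup>2 * (norm h)\<^sup>2"
        by (simp add: F_def norm_add_sq g.add g.scaleR cinner_scaleR_right c_def
            power_mult_distrib algebra_simps)
      then show ?thesis using m_le[of "y + t *\<^sub>R h"] F_y by linarith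
    qed
    \<comment> \<open>The step \<open>t = - c / N\<close> makes the quadratic negative; the summand
      1 keeps the denominator positive without a case split on \<open>h\<close>.\<close>
    define N where "N = (norm h)\<^sup>2 + 1"
    have "N > 0" by (simp add: N_def add_nonneg_pos)
    have "2 * (- c / N) * c + (- c / N)\<^sup>2 * (norm h)\<^sup>2 = - (c / N)\<^sup>2 * (2 * N - (norm h)\<^sup>2)"
      using \<open>N > 0\<close> by (simp add: field_simps power2_eq_square)
    moreover have "2 * N - (norm h)\<^sup>2 = (norm h)\<^sup>2 + 2"
      by (simp add: N_def)
    then have "0 < (c / N)\<^sup>2 * (2 * N - (norm h)\<^sup>2)"
      using \<open>c \<noteq> 0\<close> \<open>N > 0\<close> by (simp add: add_nonneg_pos)
    ultimately show False using quad[of "- c / N"] by linarith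
  qed
  then show ?thesis by blast
qed

section \<open>Existence and boundedness of the adjoint\<close>

context
  fixes T :: "'a::chilbert_space \<Rightarrow> 'a"
  assumes T: "bounded_clinear T"
begin

interpretation T: bounded_linear T
  using T by (simp add: bounded_clinear_def)

text \<open>Justifies the definite description in \<open>cadjoint\<close>: Riesz representation
  gives existence for each \<open>y\<close>, and \<open>cinner_eqI\<close> gives uniqueness.\<close>

lemma cinner_cadjoint: "cinner (T x) y = cinner x (cadjoint T y)"
proof -
  have T_scaleC: "T (c *\<^sub>C x) = c *\<^sub>C T x" for c x using T by (simp add: bounded_clinear_def)
  have "\<exists>s. \<forall>x. cinner (T x) y = cinner x s" for y
  proof -
    have "bounded_linear (\<lambda>x. Re (cinner (T x) y))"
    proof (rule bounded_linear_intro)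
      fix x
      have "cmod (cinner (T x) y) \<le> norm (T x) * norm y" by (rule cmod_cinner_le)
      also have "\<dots> \<le> (onorm T * norm x) * norm y"
        by (intro mult_right_mono onorm T.bounded_linear_axioms) auto
      finally show "norm (Re (cinner (T x) y)) \<le> norm x * (onorm T * norm y)"
        using abs_Re_le_cmod[of "cinner (T x) y"] by (simp add: mult_ac)
    qed (simp_all add: T.add T.scaleR cinner_add_left cinner_scaleR_left)
    from riesz_representation_real[OF this]
    obtain s where s: "\<And>x. Re (cinner (T x) y) = Re (cinner x s)" by blast
    have "cinner (T x) y = cinner x s" for x
      \<comment> \<open>Since Re(iz) = -Im(z), agreement of real parts at \<open>x\<close> and at i
        times \<open>x\<close> yields equality of the complex values.\<close>
      using s[of x] s[of "\<i> *\<^sub>C x"]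
      by (simp add: T_scaleC cinner_scaleC_left complex_eq_iff)
    then show ?thesis by blast
  qed
  then obtain S where S: "\<And>x y. cinner (T x) y = cinner x (S y)" by metis
  have "cadjoint T = S"
    unfolding cadjoint_def
  proof (rule the_equality)
    fix S' assume S': "\<forall>x y. cinner (T x) y = cinner x (S' y)"
    show "S' = S" by (rule ext, rule cinner_eqI) (simp add: S'[rule_format, symmetric] S[symmetric])
  qed (use S in blast)
  then show ?thesis by (simp add: S)
qed

lemma cinner_cadjoint_left: "cinner (cadjoint T x) y = cinner x (T y)"
  by (metis cinner_cadjoint cinner_commute)

lemma bounded_linear_cadjoint: "bounded_linear (cadjoint T)"
proof (rule bounded_linear_intro)
  fix x y r
  show "cadjoint T (x + y) = cadjoint T x + cadjoint T y"
    by (rule cinner_eqI) (simp add: cinner_cadjoint[symmetric] cinner_add_right)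
  show "cadjoint T (r *\<^sub>R x) = r *\<^sub>R cadjoint T x"
    by (rule cinner_eqI) (simp add: cinner_cadjoint[symmetric] cinner_scaleR_right)
  show "norm (cadjoint T x) \<le> norm x * onorm T"
  proof (cases "cadjoint T x = 0")
    case True
    then show ?thesis using onorm_pos_le[OF T.bounded_linear_axioms] by simp
  next
    case False
    let ?s = "cadjoint T x"
    \<comment> \<open>The square of the norm of the adjoint vector is moved back through
      \<open>T\<close>, so that one factor \<open>norm ?s\<close> cancels.\<close>
    have "norm ?s * norm ?s = Re (cinner (T ?s) x)"
      by (simp add: cinner_cadjoint Re_cinner_self power2_eq_square)
    also have "\<dots> \<le> norm (T ?s) * norm x" by (rule Re_cinner_le)
    also have "\<dots> \<le> (onorm T * norm ?s) * norm x"
      by (intro mult_right_mono onorm T.bounded_linear_axioms) auto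
    finally have "norm ?s * norm ?s \<le> norm ?s * (norm x * onorm T)" by (simp add: mult_ac)
    then show ?thesis using False by simp
  qed
qed

end

section \<open>Self-adjoint operators and quadratic forms\<close>

lemma bounded_linear_scaleC:
  fixes f :: "'a::complex_inner \<Rightarrow> 'a"
  assumes "bounded_linear f"
  shows "bounded_linear (\<lambda>x. c *\<^sub>C f x)"
proof -
  have "bounded_linear (\<lambda>x::'a. c *\<^sub>C x)"
    by (rule bounded_linear_intro[where K = "cmod c"])
      (simp_all add: scaleC_add_right scaleR_scaleC scaleC_scaleC mult.commute norm_scaleC)
  from bounded_linear_compose[OF this assms] show ?thesis .
qed

text \<open>For self-adjoint \<open>A\<close>, polarisation recovers Re <Ax, y> from the quadratic
  form at \<open>x + y\<close> and \<open>x - y\<close>, and the parallelogram law turns the form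
  bound into one on \<open>x\<close> and \<open>y\<close>.\<close>

lemma self_adjoint_norm_le:
  fixes A :: "'a::complex_inner \<Rightarrow> 'a"
  assumes A: "linear A" and sa: "\<And>x y. cinner (A x) y = cinner x (A y)"
    and w: "\<And>u. \<bar>Re (cinner (A u) u)\<bar> \<le> w * (norm u)\<^sup>2"
  shows "norm (A x) \<le> w * norm x"
proof -
  have polar: "2 * Re (cinner (A x) y) \<le> w * ((norm x)\<^sup>2 + (norm y)\<^sup>2)" for x y
  proof -
    have "Re (cinner (A y) x) = Re (cinner (A x) y)"
      by (metis sa Re_cinner_commute)
    then have "4 * Re (cinner (A x) y) =
        Re (cinner (A (x + y)) (x + y)) - Re (cinner (A (x - y)) (x - y))"
      by (simp add: linear_add[OF A] linear_diff[OF A] cinner_add_left cinner_add_right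
          cinner_diff_left cinner_diff_right)
    also have "\<dots> \<le> w * ((norm (x + y))\<^sup>2 + (norm (x - y))\<^sup>2)"
      using w[of "x + y"] w[of "x - y"] by (simp add: distrib_left)
    finally show ?thesis unfolding parallelogram_law by (simp add: algebra_simps)
  qed
  show ?thesis
  proof (cases "A x = 0 \<or> x = 0")
    case True
    \<comment> \<open>If \<open>A x = 0\<close> with \<open>x\<close> nonzero, the sign of
      \<open>w\<close> matters; the form bound at \<open>x\<close> forces it to be
      nonnegative.\<close>
    moreover have "0 \<le> w * norm x"
    proof (cases "x = 0")
      case False
      have "0 \<le> w * (norm x)\<^sup>2" using w[of x] by linarith
      with False show ?thesis by (simp add: zero_le_mult_iff)
    qed simp
    ultimately show ?thesis using linear_0[OF A] by auto
  next
    case False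
    (* polarise against the multiple of A x that has the same norm as x *)
    define y where "y = (norm x / norm (A x)) *\<^sub>R A x"
    have "norm y = norm x" using False by (simp add: y_def)
    moreover have "Re (cinner (A x) y) = norm x * norm (A x)"
      using False by (simp add: y_def cinner_scaleR_right Re_cinner_self power2_eq_square)
    ultimately have "norm x * norm (A x) \<le> norm x * (w * norm x)"
      using polar[of x y] by (simp add: power2_eq_square algebra_simps)
    then show ?thesis using False by simp
  qed
qed

lemma cmod_cinner_le_numerical_radius:
  fixes T :: "'a::complex_inner \<Rightarrow> 'a"
  assumes "bounded_linear T"
  shows "cmod (cinner (T u) u) \<le> numerical_radius T * (norm u)\<^sup>2"
proof (cases "u = 0")
  case True
  then show ?thesis using cmod_cinner_le[of "T u" u] by simp
next
  case False
  interpret T: bounded_linear T by fact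
  define e where "e = (1 / norm u) *\<^sub>R u"
  have e: "norm e = 1" "u = norm u *\<^sub>R e" using False by (simp_all add: e_def)
  \<comment> \<open>A real \<open>Sup\<close> dominates its elements only for a set bounded above;
    Cauchy-Schwarz and the operator norm provide the bound.\<close>
  have "bdd_above {cmod (cinner (T x) x) | x. norm x = 1}"
  proof (rule bdd_aboveI, clarify)
    fix x :: 'a assume "norm x = 1"
    then show "cmod (cinner (T x) x) \<le> onorm T"
      using cmod_cinner_le[of "T x" x] onorm[OF assms, of x] by simp
  qed
  then have "cmod (cinner (T e) e) \<le> numerical_radius T"
    unfolding numerical_radius_def by (rule cSup_upper[rotated]) (use e in blast)
  moreover have "cmod (cinner (T u) u) = cmod (cinner (T e) e) * (norm u)\<^sup>2"
    by (subst (1 2) e(2))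
      (simp add: T.scaleR cinner_scaleR_left cinner_scaleR_right norm_mult power2_eq_square)
  ultimately show ?thesis by (simp add: mult_right_mono)
qed

section \<open>Real and imaginary parts of an operator\<close>

context
  fixes T :: "'a::chilbert_space \<Rightarrow> 'a"
  assumes T: "bounded_clinear T"
begin

private lemma bl: "bounded_linear T"
  using T by (simp add: bounded_clinear_def)

lemma bounded_linear_op_Re: "bounded_linear (op_Re T)"
  unfolding op_Re_def
  by (intro bounded_linear_scaleC bounded_linear_add bl bounded_linear_cadjoint T)

lemma bounded_linear_op_Im: "bounded_linear (op_Im T)"
  unfolding op_Im_def
  by (intro bounded_linear_scaleC bounded_linear_sub bl bounded_linear_cadjoint T)

text \<open>With the scalar 1/(2i) free of division by i, conjugates simplify directly.\<close>

lemma op_Im_alt: "op_Im T x = (- \<i> / 2) *\<^sub>C (T x - cadjoint T x)"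
  by (simp add: op_Im_def complex_eq_iff Re_divide Im_divide)

lemma op_Re_self_adjoint: "cinner (op_Re T x) y = cinner x (op_Re T y)"
  by (simp add: op_Re_def cinner_scaleC_left cinner_scaleC_right cinner_add_left cinner_add_right
      cinner_cadjoint_left[OF T] cinner_cadjoint[OF T])

lemma op_Im_self_adjoint: "cinner (op_Im T x) y = cinner x (op_Im T y)"
  by (simp add: op_Im_alt cinner_scaleC_left cinner_scaleC_right cinner_diff_left cinner_diff_right
      cinner_cadjoint_left[OF T] cinner_cadjoint[OF T] algebra_simps)

text \<open>The quadratic form of the adjoint is the conjugate of that of \<open>T\<close>, so
  averaging leaves the real part; the same fact gives \<open>cinner_op_Im\<close>.\<close>

lemma cinner_op_Re: "cinner (op_Re T u) u = of_real (Re (cinner (T u) u))"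
proof -
  have "cinner (cadjoint T u) u = cnj (cinner (T u) u)"
    by (metis cinner_cadjoint_left[OF T] cinner_commute)
  then show ?thesis
    by (simp add: op_Re_def cinner_scaleC_left cinner_add_left complex_eq_iff)
qed

lemma cinner_op_Im: "cinner (op_Im T u) u = of_real (Im (cinner (T u) u))"
proof -
  have "cinner (cadjoint T u) u = cnj (cinner (T u) u)"
    by (metis cinner_cadjoint_left[OF T] cinner_commute)
  then show ?thesis
    by (simp add: op_Im_alt cinner_scaleC_left cinner_diff_left complex_eq_iff)
qed

text \<open>The form of \<open>op_Re T\<close> is a real part of the form of \<open>T\<close>, hence
  dominated by the numerical radius, and self-adjointness lifts this to the norm.\<close>

lemma norm_op_Re_le: "norm (op_Re T x) \<le> numerical_radius T * norm x"
proof (rule self_adjoint_norm_le)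
  show "\<bar>Re (cinner (op_Re T u) u)\<bar> \<le> numerical_radius T * (norm u)\<^sup>2" for u
    using order_trans[OF abs_Re_le_cmod cmod_cinner_le_numerical_radius[OF bl]]
    by (simp add: cinner_op_Re)
qed (simp_all add: bounded_linear.linear bounded_linear_op_Re op_Re_self_adjoint)

lemma norm_op_Im_le: "norm (op_Im T x) \<le> numerical_radius T * norm x"
proof (rule self_adjoint_norm_le)
  show "\<bar>Re (cinner (op_Im T u) u)\<bar> \<le> numerical_radius T * (norm u)\<^sup>2" for u
    using order_trans[OF abs_Im_le_cmod cmod_cinner_le_numerical_radius[OF bl]]
    by (simp add: cinner_op_Im)
qed (simp_all add: bounded_linear.linear bounded_linear_op_Im op_Im_self_adjoint)

text \<open>Pairing with an arbitrary \<open>z\<close> turns the vector identity into complex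
  arithmetic.\<close>

lemma cartesian_decomposition: "T x = op_Re T x + \<i> *\<^sub>C op_Im T x"
proof (rule cinner_eqI)
  fix z
  show "cinner z (T x) = cinner z (op_Re T x + \<i> *\<^sub>C op_Im T x)"
    by (simp add: op_Re_def op_Im_alt cinner_add_right cinner_scaleC_right cinner_diff_right
        algebra_simps)
qed

lemma onorm_le_Re_Im: "onorm T \<le> onorm (op_Re T) + onorm (op_Im T)"
proof (rule onorm_bound)
  fix x
  have "norm (T x) \<le> norm (op_Re T x) + norm (op_Im T x)"
    using norm_triangle_ineq[of "op_Re T x" "\<i> *\<^sub>C op_Im T x"]
    by (simp add: cartesian_decomposition[symmetric] norm_scaleC)
  also have "\<dots> \<le> (onorm (op_Re T) + onorm (op_Im T)) * norm x"
    using onorm[OF bounded_linear_op_Re, of x] onorm[OF bounded_linear_op_Im, of x]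
    by (simp add: distrib_right)
  finally show "norm (T x) \<le> (onorm (op_Re T) + onorm (op_Im T)) * norm x" .
qed (simp add: onorm_pos_le bounded_linear_op_Re bounded_linear_op_Im)

end

theorem mainTheorem16:
  fixes T :: "'a::chilbert_space \<Rightarrow> 'a"
  assumes "bounded_clinear T"
  shows "numerical_radius T = 1 / 2 * onorm T + 1 / 2 * \<bar>onorm (op_Re T) - onorm (op_Im T)\<bar>
    \<longleftrightarrow> onorm T = onorm (op_Re T) + onorm (op_Im T) \<and>
        numerical_radius T = max (onorm (op_Re T)) (onorm (op_Im T))"
proof (cases "\<forall>x::'a. x = 0")
  case True
  (* on the zero space numerical_radius T is the unspecified Sup {}, but both sides say it is 0 *)
  then have "f = (\<lambda>x. 0)" for f :: "'a \<Rightarrow> 'a"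
    by (intro ext) blast
  then have "onorm f = 0" for f :: "'a \<Rightarrow> 'a"
    by (metis onorm_zero)
  then show ?thesis by simp
next
  case False
  then obtain v :: 'a where "v \<noteq> 0" by blast
  \<comment> \<open>\<open>onorm_bound\<close> requires a nonnegative constant; a nonzero vector is
    what makes the sign of the supremum available.\<close>
  have "0 \<le> numerical_radius T * norm v"
    using norm_op_Re_le[OF assms, of v] norm_ge_zero order_trans by blast
  with \<open>v \<noteq> 0\<close> have "0 \<le> numerical_radius T" by (simp add: zero_le_mult_iff)
  then have "onorm (op_Re T) \<le> numerical_radius T" "onorm (op_Im T) \<le> numerical_radius T"
    by (simp_all add: onorm_bound norm_op_Re_le[OF assms] norm_op_Im_le[OF assms])
  with onorm_le_Re_Im[OF assms] show ?thesis by (auto simp: max_def abs_if add_divide_distrib diff_divide_distrib)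
qed

end
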